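(* Let $G$ be a graph satisfying the triangle condition at every vertex. Then $G$ is an swm-graph if and only if for every pair of vertices $p,q$ the interval $I(p,q)$, endowed with the base-point order $\preceq_p$, is a modular lattice, and the subgraph of $G$ induced by $I(p,q)$ is the covering graph of this lattice and is an isometric subgraph of $G$.
   Context: Graphs are simple, undirected, connected, possibly infinite; $d$ is graph distance, $I(p,q)=\{x:d(p,x)+d(x,q)=d(p,q)\}$. Triangle condition at $u$: for any $v,w$ with $1=d(v,w)<d(u,v)=d(u,w)$ there is a common neighbor $x$ of $v,w$ with $d(u,x)=d(u,v)-1$. Quadrangle condition at $u$: for $v,w,z$ with $d(v,z)=d(w,z)=1$, $2=d(v,w)\le d(u,v)=d(u,w)=d(u,z)-1$ there is a common neighbor $x$ of $v,w$ with $d(u,x)=d(u,v)-1$. Weakly modular: both conditions hold at every vertex. An swm-graph is a weakly modular graph containing no induced $K_4^-$ and no isometric $K_{3,3}^-$ ($K_4$, resp. $K_{3,3}$, minus one edge). The base-point order on $I(p,q)$ is $x\preceq_p y$ iff $x\in I(p,y)$. A lattice is modular if $x\vee(y\wedge z)=(x\vee y)\wedge z$ whenever $x\preceq z$. The covering graph of a poset has an edge between $x,y$ iff one covers the other. *)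

theory Defs
  imports Main "HOL-Algebra.Lattice"
begin

definition simple_graph :: "'a set \<Rightarrow> ('a \<Rightarrow> 'a \<Rightarrow> bool) \<Rightarrow> bool" where
  "simple_graph V E \<longleftrightarrow> (\<forall>x y. E x y \<longrightarrow> x \<in> V \<and> y \<in> V) \<and>
     (\<forall>x y. E x y \<longrightarrow> E y x) \<and> (\<forall>x. \<not> E x x)"

definition walk_in :: "('a \<Rightarrow> 'a \<Rightarrow> bool) \<Rightarrow> 'a set \<Rightarrow> 'a list \<Rightarrow> bool" where
  "walk_in E S xs \<longleftrightarrow> xs \<noteq> [] \<and> set xs \<subseteq> S \<and>
     (\<forall>i. Suc i < length xs \<longrightarrow> E (xs ! i) (xs ! Suc i))"

definition walk_of_len :: "('a \<Rightarrow> 'a \<Rightarrow> bool) \<Rightarrow> 'a set \<Rightarrow> 'a \<Rightarrow> 'a \<Rightarrow> nat \<Rightarrow> bool" where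
  "walk_of_len E S x y n \<longleftrightarrow>
     (\<exists>xs. walk_in E S xs \<and> hd xs = x \<and> last xs = y \<and> length xs = Suc n)"

definition reachable_in :: "('a \<Rightarrow> 'a \<Rightarrow> bool) \<Rightarrow> 'a set \<Rightarrow> 'a \<Rightarrow> 'a \<Rightarrow> bool" where
  "reachable_in E S x y \<longleftrightarrow> (\<exists>n. walk_of_len E S x y n)"

definition connected_graph :: "'a set \<Rightarrow> ('a \<Rightarrow> 'a \<Rightarrow> bool) \<Rightarrow> bool" where
  "connected_graph V E \<longleftrightarrow> simple_graph V E \<and> (\<forall>x\<in>V. \<forall>y\<in>V. reachable_in E V x y)"

text \<open>Graph distance in the subgraph induced by S (meaningful when y is reachable from x in S).\<close>
definition gdist :: "('a \<Rightarrow> 'a \<Rightarrow> bool) \<Rightarrow> 'a set \<Rightarrow> 'a \<Rightarrow> 'a \<Rightarrow> nat" where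
  "gdist E S x y = (LEAST n. walk_of_len E S x y n)"

definition isometric_subgraph :: "'a set \<Rightarrow> ('a \<Rightarrow> 'a \<Rightarrow> bool) \<Rightarrow> 'a set \<Rightarrow> bool" where
  "isometric_subgraph V E S \<longleftrightarrow> S \<subseteq> V \<and>
     (\<forall>x\<in>S. \<forall>y\<in>S. reachable_in E S x y \<and> gdist E S x y = gdist E V x y)"

definition interval :: "'a set \<Rightarrow> ('a \<Rightarrow> 'a \<Rightarrow> bool) \<Rightarrow> 'a \<Rightarrow> 'a \<Rightarrow> 'a set" where
  "interval V E p q = {x \<in> V. gdist E V p x + gdist E V x q = gdist E V p q}"

definition triangle_cond :: "'a set \<Rightarrow> ('a \<Rightarrow> 'a \<Rightarrow> bool) \<Rightarrow> 'a \<Rightarrow> bool" where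
  "triangle_cond V E u \<longleftrightarrow> (\<forall>v\<in>V. \<forall>w\<in>V.
     gdist E V v w = 1 \<and> 1 < gdist E V u v \<and> gdist E V u v = gdist E V u w \<longrightarrow>
     (\<exists>x\<in>V. E x v \<and> E x w \<and> gdist E V u x = gdist E V u v - 1))"

definition quadrangle_cond :: "'a set \<Rightarrow> ('a \<Rightarrow> 'a \<Rightarrow> bool) \<Rightarrow> 'a \<Rightarrow> bool" where
  "quadrangle_cond V E u \<longleftrightarrow> (\<forall>v\<in>V. \<forall>w\<in>V. \<forall>z\<in>V.
     gdist E V v z = 1 \<and> gdist E V w z = 1 \<and> gdist E V v w = 2 \<and>
     2 \<le> gdist E V u v \<and> gdist E V u v = gdist E V u w \<and>
     gdist E V u w = gdist E V u z - 1 \<and> gdist E V u z \<ge> 1 \<longrightarrow>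
     (\<exists>x\<in>V. E x v \<and> E x w \<and> gdist E V u x = gdist E V u v - 1))"

definition weakly_modular :: "'a set \<Rightarrow> ('a \<Rightarrow> 'a \<Rightarrow> bool) \<Rightarrow> bool" where
  "weakly_modular V E \<longleftrightarrow> (\<forall>u\<in>V. triangle_cond V E u \<and> quadrangle_cond V E u)"

definition has_induced_K4_minus :: "'a set \<Rightarrow> ('a \<Rightarrow> 'a \<Rightarrow> bool) \<Rightarrow> bool" where
  "has_induced_K4_minus V E \<longleftrightarrow> (\<exists>a\<in>V. \<exists>b\<in>V. \<exists>c\<in>V. \<exists>d\<in>V.
     distinct [a, b, c, d] \<and> E a b \<and> E a c \<and> E a d \<and> E b c \<and> E b d \<and> \<not> E c d)"

definition has_isometric_K33_minus :: "'a set \<Rightarrow> ('a \<Rightarrow> 'a \<Rightarrow> bool) \<Rightarrow> bool" where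
  "has_isometric_K33_minus V E \<longleftrightarrow> (\<exists>a1\<in>V. \<exists>a2\<in>V. \<exists>a3\<in>V. \<exists>b1\<in>V. \<exists>b2\<in>V. \<exists>b3\<in>V.
     distinct [a1, a2, a3, b1, b2, b3] \<and>
     (\<forall>x\<in>{a1,a2,a3,b1,b2,b3}. \<forall>y\<in>{a1,a2,a3,b1,b2,b3}.
        E x y \<longleftrightarrow> ((x \<in> {a1,a2,a3} \<and> y \<in> {b1,b2,b3}) \<or> (y \<in> {a1,a2,a3} \<and> x \<in> {b1,b2,b3}))
                  \<and> {x, y} \<noteq> {a1, b1}) \<and>
     isometric_subgraph V E {a1,a2,a3,b1,b2,b3})"

definition swm_graph :: "'a set \<Rightarrow> ('a \<Rightarrow> 'a \<Rightarrow> bool) \<Rightarrow> bool" where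
  "swm_graph V E \<longleftrightarrow> weakly_modular V E \<and> \<not> has_induced_K4_minus V E \<and>
     \<not> has_isometric_K33_minus V E"

definition interval_poset :: "'a set \<Rightarrow> ('a \<Rightarrow> 'a \<Rightarrow> bool) \<Rightarrow> 'a \<Rightarrow> 'a \<Rightarrow> 'a gorder" where
  "interval_poset V E p q = \<lparr> carrier = interval V E p q, eq = (=),
     le = (\<lambda>x y. x \<in> interval V E p y) \<rparr>"

definition modular_lattice :: "('a, 'b) gorder_scheme \<Rightarrow> bool" where
  "modular_lattice L \<longleftrightarrow> lattice L \<and>
     (\<forall>x\<in>carrier L. \<forall>y\<in>carrier L. \<forall>z\<in>carrier L. x \<sqsubseteq>\<^bsub>L\<^esub> z \<longrightarrow>
        x \<squnion>\<^bsub>L\<^esub> (y \<sqinter>\<^bsub>L\<^esub> z) = (x \<squnion>\<^bsub>L\<^esub> y) \<sqinter>\<^bsub>L\<^esub> z)"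

definition covers :: "('a, 'b) gorder_scheme \<Rightarrow> 'a \<Rightarrow> 'a \<Rightarrow> bool" where
  "covers L x y \<longleftrightarrow> x \<in> carrier L \<and> y \<in> carrier L \<and> x \<sqsubset>\<^bsub>L\<^esub> y \<and>
     \<not> (\<exists>z\<in>carrier L. x \<sqsubset>\<^bsub>L\<^esub> z \<and> z \<sqsubset>\<^bsub>L\<^esub> y)"

definition induced_is_covering_graph :: "('a \<Rightarrow> 'a \<Rightarrow> bool) \<Rightarrow> ('a, 'b) gorder_scheme \<Rightarrow> bool" where
  "induced_is_covering_graph E L \<longleftrightarrow> (\<forall>x\<in>carrier L. \<forall>y\<in>carrier L.
     E x y \<longleftrightarrow> covers L x y \<or> covers L y x)"

end

(* If two vertices of an interval are adjacent, they lie on different levels: otherwise the triangle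
   condition from both ends produces an induced K4 minus an edge. The quadrangle condition gives two
   elements with a common lower cover a common upper cover, unique because two of them would
   complete to an isometric K33 minus an edge; from this all joins, and dually meets, arise by
   induction, and the rank is both upper and lower semimodular, hence modular. Isometry rests on
   a descent property of weakly modular graphs: if w is closer to u than v, some neighbour
   of v is closer to both u and w. Conversely, the forbidden subgraphs contradict the covering
   graph and the existence of joins, and modularity forces the meet of two lower covers of z to be
   covered by both, which is the quadrangle condition. *)
theory Submission
  imports Defs
begin

section \<open>Walks and their lengths\<close>

lemma walk_of_len_0: "walk_of_len E S x y 0 \<longleftrightarrow> x = y \<and> x \<in> S"
proof
  assume "walk_of_len E S x y 0"
  then obtain xs where "walk_in E S xs" "hd xs = x" "last xs = y" "length xs = Suc 0"
    unfolding walk_of_len_def by auto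
  then show "x = y \<and> x \<in> S"
    by (cases xs) (auto simp: walk_in_def)
next
  assume "x = y \<and> x \<in> S"
  then show "walk_of_len E S x y 0"
    unfolding walk_of_len_def walk_in_def by (intro exI[of _ "[x]"]) auto
qed

lemma walk_in_Cons:
  "walk_in E S (x # xs) \<longleftrightarrow> x \<in> S \<and> (xs = [] \<or> E x (hd xs) \<and> walk_in E S xs)"
  unfolding walk_in_def
  by (cases xs) (auto simp: less_Suc_eq_0_disj)

text \<open>Together with the length-zero case this replaces vertex lists by a recursion on the
  length, on which the later inductions over walks run.\<close>

lemma walk_of_len_Suc:
  "walk_of_len E S x y (Suc n) \<longleftrightarrow> (\<exists>z. x \<in> S \<and> E x z \<and> walk_of_len E S z y n)"
proof
  assume "walk_of_len E S x y (Suc n)"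
  then obtain xs where xs: "walk_in E S xs" "hd xs = x" "last xs = y" "length xs = Suc (Suc n)"
    unfolding walk_of_len_def by auto
  then obtain ys where ys: "xs = x # ys" "length ys = Suc n" by (cases xs) auto
  moreover have "ys \<noteq> []" using ys by auto
  ultimately show "\<exists>z. x \<in> S \<and> E x z \<and> walk_of_len E S z y n"
    using xs unfolding walk_of_len_def
    by (intro exI[of _ "hd ys"]) (auto simp: walk_in_Cons intro!: exI[of _ ys])
next
  assume "\<exists>z. x \<in> S \<and> E x z \<and> walk_of_len E S z y n"
  then obtain z xs where "x \<in> S" "E x z" "walk_in E S xs" "hd xs = z" "last xs = y" "length xs = Suc n"
    unfolding walk_of_len_def by auto
  then show "walk_of_len E S x y (Suc n)"
    unfolding walk_of_len_def
    by (intro exI[of _ "x # xs"]) (auto simp: walk_in_Cons)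
qed

lemma walk_of_len_trans:
  "walk_of_len E S x y m \<Longrightarrow> walk_of_len E S y z n \<Longrightarrow> walk_of_len E S x z (m + n)"
  by (induction m arbitrary: x) (auto simp: walk_of_len_0 walk_of_len_Suc)

lemma walk_of_len_in: "walk_of_len E S x y n \<Longrightarrow> x \<in> S \<and> y \<in> S"
  by (induction n arbitrary: x) (auto simp: walk_of_len_0 walk_of_len_Suc)

lemma walk_of_len_mono: "walk_of_len E S x y n \<Longrightarrow> S \<subseteq> T \<Longrightarrow> walk_of_len E T x y n"
  by (induction n arbitrary: x) (auto simp: walk_of_len_0 walk_of_len_Suc)

lemma walk_of_len_sym:
  assumes "\<And>x y. E x y \<Longrightarrow> E y x"
  shows "walk_of_len E S x y n \<Longrightarrow> walk_of_len E S y x n"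
proof (induction n arbitrary: x)
  case (Suc n)
  then obtain z where z: "x \<in> S" "E x z" "walk_of_len E S z y n" by (auto simp: walk_of_len_Suc)
  then have "walk_of_len E S z x (Suc 0)"
    using assms walk_of_len_in by (fastforce simp: walk_of_len_0 walk_of_len_Suc)
  with Suc.IH[OF z(3)] show ?case using walk_of_len_trans by fastforce
qed (auto simp: walk_of_len_0)

lemma gdist_le: "walk_of_len E S x y n \<Longrightarrow> gdist E S x y \<le> n"
  unfolding gdist_def by (rule Least_le)

lemma gdist_walk: "reachable_in E S x y \<Longrightarrow> walk_of_len E S x y (gdist E S x y)"
  unfolding gdist_def reachable_in_def by (metis LeastI)

section \<open>Distances and intervals\<close>

locale conn_graph =
  fixes V :: "'a set" and E :: "'a \<Rightarrow> 'a \<Rightarrow> bool"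
  assumes conn: "connected_graph V E"
begin

abbreviation d :: "'a \<Rightarrow> 'a \<Rightarrow> nat" where "d \<equiv> gdist E V"
abbreviation I :: "'a \<Rightarrow> 'a \<Rightarrow> 'a set" where "I \<equiv> interval V E"

lemma adj_sym: "E x y \<Longrightarrow> E y x"
  and adj_V: "E x y \<Longrightarrow> x \<in> V \<and> y \<in> V"
  and adj_irrefl: "\<not> E x x"
  using conn unfolding connected_graph_def simple_graph_def by blast+

lemma dist_walk: "x \<in> V \<Longrightarrow> y \<in> V \<Longrightarrow> walk_of_len E V x y (d x y)"
  using conn unfolding connected_graph_def by (blast intro: gdist_walk)

lemma dist_refl [simp]: "x \<in> V \<Longrightarrow> d x x = 0"
  using gdist_le[of E V x x 0] by (auto simp: walk_of_len_0)

lemma dist_eq_0: "x \<in> V \<Longrightarrow> y \<in> V \<Longrightarrow> d x y = 0 \<longleftrightarrow> x = y"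
  using dist_walk[of x y] by (auto simp: walk_of_len_0)

lemma dist_sym: "x \<in> V \<Longrightarrow> y \<in> V \<Longrightarrow> d x y = d y x"
  using gdist_le walk_of_len_sym adj_sym dist_walk by (metis le_antisym)

lemma dist_triangle: "x \<in> V \<Longrightarrow> y \<in> V \<Longrightarrow> z \<in> V \<Longrightarrow> d x z \<le> d x y + d y z"
  by (meson gdist_le walk_of_len_trans dist_walk)

lemma adj_iff_dist: "x \<in> V \<Longrightarrow> y \<in> V \<Longrightarrow> E x y \<longleftrightarrow> d x y = 1"
proof
  assume xy: "x \<in> V" "y \<in> V" and "E x y"
  then have "walk_of_len E V x y 1" by (auto simp: walk_of_len_0 walk_of_len_Suc)
  then have "d x y \<le> 1" by (rule gdist_le)
  moreover have "d x y \<noteq> 0" using xy \<open>E x y\<close> adj_irrefl dist_eq_0 by auto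
  ultimately show "d x y = 1" by simp
next
  assume "x \<in> V" "y \<in> V" "d x y = 1"
  then show "E x y" using dist_walk[of x y] by (auto simp: walk_of_len_0 walk_of_len_Suc)
qed

lemma adj_dist: "E x y \<Longrightarrow> d x y = 1"
  using adj_iff_dist adj_V by blast

lemma adj_dist_le:
  assumes "E x y" "z \<in> V"
  shows "d z x \<le> Suc (d z y)" "d z y \<le> Suc (d z x)" "d x z \<le> Suc (d y z)" "d y z \<le> Suc (d x z)"
proof -
  have V: "x \<in> V" "y \<in> V" using adj_V assms by auto
  have 1: "d x y = 1" "d y x = 1" using assms adj_dist adj_sym by auto
  show "d z x \<le> Suc (d z y)" "d z y \<le> Suc (d z x)" "d x z \<le> Suc (d y z)" "d y z \<le> Suc (d x z)"
    using dist_triangle[of z y x] dist_triangle[of z x y] dist_triangle[of x y z]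
      dist_triangle[of y x z] V assms 1 by auto
qed

lemma geodesic_step:
  assumes "x \<in> V" "y \<in> V" "x \<noteq> y"
  shows "\<exists>z. E x z \<and> Suc (d z y) = d x y"
proof -
  obtain n where n: "d x y = Suc n" using assms dist_eq_0 by (cases "d x y") auto
  then obtain z where z: "E x z" "walk_of_len E V z y n"
    using dist_walk[of x y] assms by (auto simp: walk_of_len_Suc)
  then have "d z y \<le> n" by (blast intro: gdist_le)
  moreover have "d x y \<le> Suc (d z y)" using adj_dist_le z assms by auto
  ultimately show ?thesis using z n by auto
qed

lemma interval_V: "x \<in> I p q \<Longrightarrow> x \<in> V"
  by (simp add: interval_def)

lemma interval_iff: "x \<in> I p q \<longleftrightarrow> x \<in> V \<and> d p x + d x q = d p q"
  by (simp add: interval_def)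

lemma interval_commute: "p \<in> V \<Longrightarrow> q \<in> V \<Longrightarrow> I p q = I q p"
  by (auto simp: interval_iff dist_sym)

text \<open>Reduces isometry to single steps: iterating the step gives a walk inside
  \<open>S\<close> of length \<open>d x y\<close>, and nothing inside \<open>S\<close> is shorter
  because walks in \<open>S\<close> are walks in \<open>V\<close>.\<close>

lemma isometric_subgraphI:
  assumes "S \<subseteq> V"
    and step: "\<And>x y. x \<in> S \<Longrightarrow> y \<in> S \<Longrightarrow> x \<noteq> y \<Longrightarrow> \<exists>z\<in>S. E x z \<and> Suc (d z y) = d x y"
  shows "isometric_subgraph V E S"
proof -
  have w: "walk_of_len E S x y (d x y)" if "x \<in> S" "y \<in> S" for x y
    using that
  proof (induction "d x y" arbitrary: x)
    case 0
    then have "x = y" using dist_eq_0[of x y] \<open>S \<subseteq> V\<close> by auto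
    then show ?case using 0 \<open>S \<subseteq> V\<close> by (auto simp: walk_of_len_0)
  next
    case (Suc n)
    then have "x \<noteq> y" using \<open>S \<subseteq> V\<close> by auto
    then obtain z where z: "z \<in> S" "E x z" "Suc (d z y) = d x y" using step Suc by blast
    have "walk_of_len E S z y (d z y)"
      using Suc.hyps(1)[of z] Suc.hyps(2) Suc.prems z by simp
    then have "walk_of_len E S x y (Suc (d z y))"
      unfolding walk_of_len_Suc using z(1,2) Suc.prems by blast
    then show ?case using z by simp
  qed
  have "gdist E S x y = d x y" if "x \<in> S" "y \<in> S" for x y
  proof (rule antisym)
    show "gdist E S x y \<le> d x y" using w that by (blast intro: gdist_le)
    have "walk_of_len E S x y (gdist E S x y)"
      using w that unfolding reachable_in_def[symmetric] by (metis gdist_walk reachable_in_def)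
    then show "d x y \<le> gdist E S x y" using walk_of_len_mono[OF _ \<open>S \<subseteq> V\<close>] gdist_le by metis
  qed
  then show ?thesis using w \<open>S \<subseteq> V\<close> unfolding isometric_subgraph_def reachable_in_def by blast
qed

section \<open>The base-point order on an interval and its covering relation\<close>

lemma interval_trans: "p \<in> V \<Longrightarrow> q \<in> V \<Longrightarrow> y \<in> I p q \<Longrightarrow> x \<in> I p y \<Longrightarrow> x \<in> I p q"
  using dist_triangle[of x y q] dist_triangle[of p x q] by (auto simp: interval_iff)

text \<open>Exchanging the endpoints reverses the base-point order; meets are later obtained from
  joins in this way.\<close>

lemma interval_reverse:
  assumes "p \<in> V" "q \<in> V" "x \<in> I p q" "y \<in> I p q"
  shows "x \<in> I p y \<longleftrightarrow> y \<in> I q x"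
  using assms dist_sym[of x y] dist_sym[of x q] dist_sym[of y q] by (auto simp: interval_iff)

lemma interval_antisym: "p \<in> V \<Longrightarrow> x \<in> I p y \<Longrightarrow> y \<in> I p x \<Longrightarrow> x = y"
  using dist_sym[of x y] dist_eq_0[of x y] by (auto simp: interval_iff)

text \<open>The next vertex on a geodesic from \<open>x\<close> to \<open>y\<close> works: the level
  \<open>d p\<close> has to rise by \<open>d x y\<close> in as many steps, so it rises at each of
  them.\<close>

lemma interval_cover:
  assumes "p \<in> V" "q \<in> V" "x \<in> I p q" "y \<in> I p q" "x \<in> I p y" "x \<noteq> y"
  shows "\<exists>x'\<in>I p q. E x x' \<and> x \<in> I p x' \<and> x' \<in> I p y \<and> d p x' = Suc (d p x)"
proof -
  have V: "x \<in> V" "y \<in> V" using assms interval_V by auto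
  obtain z where z: "E x z" "Suc (d z y) = d x y" using geodesic_step V assms by blast
  have "z \<in> V" using z adj_V by blast
  then have "d p z = Suc (d p x)"
    using assms adj_dist_le[OF z(1), of p] dist_triangle[of p z y] V z by (auto simp: interval_iff)
  then have "z \<in> I p y" "x \<in> I p z"
    using assms z V \<open>z \<in> V\<close> adj_dist[OF z(1)] by (auto simp: interval_iff)
  then show ?thesis using \<open>d p z = Suc (d p x)\<close> z assms interval_trans by blast
qed

text \<open>The level \<open>d p\<close> acts as a rank: a cover has to be the vertex found by
  \<open>interval_cover\<close>, and nothing fits strictly between two consecutive levels.\<close>

lemma interval_covers_iff:
  assumes pq: "p \<in> V" "q \<in> V"
  shows "covers (interval_poset V E p q) x y \<longleftrightarrow>
    x \<in> I p q \<and> y \<in> I p q \<and> E x y \<and> d p y = Suc (d p x)"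
    (is "?cov \<longleftrightarrow> ?adj")
proof -
  let ?L = "interval_poset V E p q"
  have c: "carrier ?L = I p q" "lless ?L a b \<longleftrightarrow> a \<in> I p b \<and> a \<noteq> b" for a b
    by (auto simp: interval_poset_def lless_def)
  show ?thesis
  proof
    assume cov: ?cov
    then have xy: "x \<in> I p q" "y \<in> I p q" "x \<in> I p y" "x \<noteq> y"
      by (auto simp: covers_def c)
    then obtain z where z: "z \<in> I p q" "E x z" "x \<in> I p z" "z \<in> I p y" "d p z = Suc (d p x)"
      using interval_cover[OF pq] by blast
    then have "z = y" using cov by (auto simp: covers_def c)
    then show ?adj using z xy by blast
  next
    assume A: ?adj
    then have V: "x \<in> V" "y \<in> V" using interval_V by auto
    have "x \<in> I p y" using A V adj_dist by (auto simp: interval_iff)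
    moreover have False
      if "z \<in> I p q" "x \<in> I p z" "x \<noteq> z" "z \<in> I p y" "z \<noteq> y" for z
      using that A V dist_eq_0[of x z] dist_eq_0[of z y] by (auto simp: interval_iff)
    ultimately show ?cov using A adj_irrefl unfolding covers_def c by blast
  qed
qed

end

locale tri_graph = conn_graph +
  assumes tri: "\<forall>u\<in>V. triangle_cond V E u"
begin

text \<open>Removes the lower bound on \<open>d u v\<close> from the triangle condition: at distance
  0 both vertices would be \<open>u\<close>, and at distance 1 the vertex \<open>u\<close> itself
  serves.\<close>

lemma triangle:
  assumes "u \<in> V" "E v w" "d u v = d u w"
  shows "\<exists>x. E x v \<and> E x w \<and> Suc (d u x) = d u v"
proof -
  have V: "v \<in> V" "w \<in> V" using assms adj_V by auto
  have ne: "v \<noteq> w" using assms adj_irrefl by auto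
  consider "d u v = 0" | "d u v = 1" | "1 < d u v" by linarith
  then show ?thesis
  proof cases
    case 1
    then show ?thesis using assms V ne dist_eq_0 by metis
  next
    case 2
    then have "E u v" "E u w" using assms V adj_iff_dist by auto
    then show ?thesis using 2 assms by auto
  next
    case 3
    then obtain x where "E x v" "E x w" "d u x = d u v - 1"
      using tri assms V adj_dist[OF assms(2)] unfolding triangle_cond_def by blast
    then show ?thesis using 3 by auto
  qed
qed

end

section \<open>Descent and isometry of intervals\<close>

locale swm = conn_graph +
  assumes swm: "swm_graph V E"

sublocale swm \<subseteq> tri_graph
  using swm by unfold_locales (auto simp: swm_graph_def weakly_modular_def)

context swm
begin

text \<open>As for triangles, small distances are settled by \<open>u\<close> itself; distance 2
  between \<open>v\<close> and \<open>w\<close> follows from their being distinct, nonadjacent and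
  joined to \<open>z\<close>.\<close>

lemma quadrangle:
  assumes "u \<in> V" "E z v" "E z w" "v \<noteq> w" "\<not> E v w" "d u v = d u w" "d u z = Suc (d u v)"
  shows "\<exists>x. E x v \<and> E x w \<and> Suc (d u x) = d u v"
proof -
  have V: "v \<in> V" "w \<in> V" "z \<in> V" using assms adj_V by auto
  consider "d u v = 0" | "d u v = 1" | "2 \<le> d u v" by linarith
  then show ?thesis
  proof cases
    case 1
    then show ?thesis using assms V dist_eq_0 by metis
  next
    case 2
    then have "E u v" "E u w" using assms V adj_iff_dist by auto
    then show ?thesis using 2 assms by auto
  next
    case 3
    have vz: "d v z = 1" "d w z = 1" using assms adj_sym adj_dist by auto
    have "d v w \<noteq> 0" "d v w \<noteq> 1" using assms V adj_iff_dist dist_eq_0 by auto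
    moreover have "d v w \<le> 2"
      using dist_triangle[of v z w] adj_dist[OF assms(3)] V vz by simp
    ultimately have "d v w = 2" by linarith
    moreover have "quadrangle_cond V E u"
      using swm assms(1) by (auto simp: swm_graph_def weakly_modular_def)
    ultimately obtain x where "E x v" "E x w" "d u x = d u v - 1"
      using 3 assms V vz unfolding quadrangle_cond_def
      by (metis diff_Suc_1 le_add1 plus_1_eq_Suc)
    then show ?thesis using 3 by auto
  qed
qed

lemma no_K4_minus:
  "E a b \<Longrightarrow> E a c \<Longrightarrow> E a d' \<Longrightarrow> E b c \<Longrightarrow> E b d' \<Longrightarrow> c \<noteq> d' \<Longrightarrow> E c d'"
  using swm adj_V adj_irrefl
  unfolding swm_graph_def has_induced_K4_minus_def distinct.simps
  by (metis empty_iff empty_set set_ConsD)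

lemma no_horizontal_edge:
  assumes "p \<in> V" "q \<in> V" "x \<in> I p q" "y \<in> I p q" "d p x = d p y"
  shows "\<not> E x y"
proof
  assume E: "E x y"
  have V: "x \<in> V" "y \<in> V" using assms interval_V by auto
  have "d q x = d q y" using assms V dist_sym[of q] by (auto simp: interval_iff)
  obtain u where u: "E u x" "E u y" "Suc (d p u) = d p x" using triangle assms E by blast
  obtain w where w: "E w x" "E w y" "Suc (d q w) = d q x" using triangle assms E \<open>d q x = d q y\<close> by blast
  have uw: "u \<in> V" "w \<in> V" using u w adj_V by auto
  \<comment> \<open>The apexes \<open>u\<close> and \<open>w\<close> lie strictly on opposite sides
    of the level of \<open>x\<close>, hence two levels apart, while both are joined to
    \<open>x\<close> and \<open>y\<close>.\<close>
  have "d p w > d p x"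
    using dist_triangle[of p w q] dist_sym[of q] w assms V uw by (auto simp: interval_iff)
  then have "d p w > Suc (d p u)" using u by simp
  then have "u \<noteq> w" "\<not> E u w" using adj_dist_le[of u w p] assms by auto
  then show False using no_K4_minus[of x y u w] u w E adj_sym by blast
qed

text \<open>If \<open>w'\<close> lies below the level of \<open>v\<close>, descend from \<open>v\<close> towards \<open>w'\<close>. If it lies above, a
  descent from \<open>w'\<close> towards \<open>v\<close> and one quadrangle give a neighbour of \<open>w\<close> one level lower and
  closer to \<open>v\<close>, towards which \<open>v\<close> can descend.\<close>
lemma detour_step:
  assumes IH: "\<And>v w. v \<in> V \<Longrightarrow> w \<in> V \<Longrightarrow> d v w < k \<Longrightarrow> d u w < d u v \<Longrightarrow>
      \<exists>v'. E v v' \<and> Suc (d v' w) = d v w \<and> Suc (d u v') = d u v"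
    and V: "u \<in> V" "v \<in> V" "w \<in> V" and k: "d v w = k"
    and w': "E w w'" "Suc (d v w') = k" and lev: "d u v = d u w" "d u w' \<noteq> d u v"
  shows "\<exists>v'. E v v' \<and> Suc (d v' w) = k \<and> Suc (d u v') = d u v"
proof (cases "d u w' < d u v")
  case True
  have w'V: "w' \<in> V" using w' adj_V by blast
  then obtain v' where v': "E v v'" "Suc (d v' w') = d v w'" "Suc (d u v') = d u v"
    using IH[of v w'] V w' True by auto
  have "v' \<in> V" using v' adj_V by blast
  then have "Suc (d v' w) = k"
    using adj_dist_le[OF w'(1), of v'] adj_dist_le[OF v'(1), of w] V v' k w' by linarith
  then show ?thesis using v' by blast
next
  case False
  have w'V: "w' \<in> V" using w' adj_V by blast
  have up: "d u w' = Suc (d u v)" using False lev adj_dist_le[OF w'(1), of u] V by linarith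
  \<comment> \<open>Descent with the roles exchanged: from \<open>w'\<close> towards
    \<open>v\<close>, at distance \<open>k - 1\<close>.\<close>
  then obtain x where x: "E w' x" "Suc (d x v) = d w' v" "Suc (d u x) = d u w'"
    using IH[of w' v] V w' w'V dist_sym[of v w'] by auto
  have xV: "x \<in> V" using x adj_V by blast
  have "Suc (Suc (d v x)) = k" using x w' V w'V xV dist_sym by metis
  \<comment> \<open>The distances of \<open>w\<close> and \<open>x\<close> from \<open>v\<close>
    differ by 2, so these two lower neighbours of \<open>w'\<close> meet the hypotheses of the
    quadrangle condition.\<close>
  then have "w \<noteq> x" "\<not> E w x" using adj_dist_le[of w x v] V k by auto
  then obtain s where s: "E s w" "E s x" "Suc (d u s) = d u w"
    using quadrangle[of u w' w x] w' x up lev V adj_sym by auto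
  have sV: "s \<in> V" using s adj_V by blast
  have "d v s < k" using adj_dist_le[OF s(2), of v] V \<open>Suc (Suc (d v x)) = k\<close> by linarith
  moreover have "d u s < d u v" using s lev by linarith
  ultimately obtain v' where v': "E v v'" "Suc (d v' s) = d v s" "Suc (d u v') = d u v"
    using IH[of v s] V sV by auto
  have "v' \<in> V" using v' adj_V by blast
  then have "Suc (d v' w) = k"
    using adj_dist_le[OF s(1), of v'] adj_dist_le[OF v'(1), of w] V v' k \<open>d v s < k\<close> by linarith
  then show ?thesis using v' by blast
qed

text \<open>Descent for \<open>d u w < d u v\<close> is proved simultaneously with a weaker version for
  \<open>d u w = d u v\<close>, which generalizes the triangle condition to non-adjacent \<open>v\<close>, \<open>w\<close>.\<close>
lemma descent_aux:
  assumes "u \<in> V"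
  shows "(\<forall>v\<in>V. \<forall>w\<in>V. d v w = k \<and> d u w < d u v \<longrightarrow>
      (\<exists>v'. E v v' \<and> Suc (d v' w) = k \<and> Suc (d u v') = d u v)) \<and>
    (\<forall>v\<in>V. \<forall>w\<in>V. d v w = k \<and> v \<noteq> w \<and> d u w = d u v \<longrightarrow>
      (\<exists>v'. E v v' \<and> d v' w \<le> k \<and> Suc (d u v') = d u v))"
proof (induction k rule: less_induct)
  case (less k)
  have C: "\<exists>v'. E v v' \<and> Suc (d v' w) = d v w \<and> Suc (d u v') = d u v"
    if "v \<in> V" "w \<in> V" "d v w < k" "d u w < d u v" for v w
    using less that by blast
  have D: "\<exists>v'. E v v' \<and> d v' w \<le> d v w \<and> Suc (d u v') = d u v"
    if "v \<in> V" "w \<in> V" "d v w < k" "v \<noteq> w" "d u w = d u v" for v w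
    using less that by blast
  \<comment> \<open>A descent towards \<open>x\<close> is also one towards its neighbour
    \<open>w\<close>: the new vertex has distance at most \<open>k - 2\<close> from
    \<open>x\<close>, hence at most \<open>k - 1\<close> from \<open>w\<close>.\<close>
  have via: "\<exists>v'. E v v' \<and> Suc (d v' w) = k \<and> Suc (d u v') = d u v"
    if vw: "v \<in> V" "w \<in> V" "d v w = k" "E w x" "d v x < k" "d u x < d u v" for v w x
  proof -
    have xV: "x \<in> V" using vw adj_V by blast
    then obtain v' where v': "E v v'" "Suc (d v' x) = d v x" "Suc (d u v') = d u v"
      using C[of v x] vw by blast
    have "v' \<in> V" using v' adj_V by blast
    then have "Suc (d v' w) = k"
      using adj_dist_le[OF \<open>E w x\<close>, of v'] adj_dist_le[OF v'(1), of w] vw v' by linarith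
    then show ?thesis using v' by blast
  qed
  show ?case
  proof (intro conjI ballI impI; elim conjE)
    fix v w
    assume V: "v \<in> V" "w \<in> V" and k: "d v w = k" and lt: "d u w < d u v"
    have "v \<noteq> w" using lt by auto
    then obtain w' where w': "E w w'" "Suc (d w' v) = d w v" using geodesic_step[of w v] V by auto
    have w'V: "w' \<in> V" using w' adj_V by blast
    have vw': "Suc (d v w') = k" using w' k V w'V dist_sym by metis
    show "\<exists>v'. E v v' \<and> Suc (d v' w) = k \<and> Suc (d u v') = d u v"
    proof (cases "d u w' < d u v")
      case True
      then show ?thesis using via[of v w w'] V k w' vw' by auto
    next
      case False
      \<comment> \<open>In the remaining case \<open>w'\<close> is on the level of \<open>v\<close>
        and \<open>w\<close> is exactly one level lower, so the weak version applies to
        \<open>v\<close> and \<open>w'\<close>.\<close>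
      then have lev: "d u w' = d u v" "Suc (d u w) = d u v"
        using lt adj_dist_le[OF w'(1) assms] by auto
      show ?thesis
      proof (cases "v = w'")
        case True
        have "E v w" using True w' adj_sym by blast
        then show ?thesis using True k vw' lev V by (intro exI[of _ w]) auto
      next
        case False
        then obtain v' where v': "E v v'" "d v' w' \<le> d v w'" "Suc (d u v') = d u v"
          using D[of v w'] V w'V vw' lev by auto
        have v'V: "v' \<in> V" using v' adj_V by blast
        show ?thesis
        proof (cases "Suc (d v' w) = k")
          case True
          then show ?thesis using v' by blast
        next
          \<comment> \<open>Here \<open>v'\<close> got no closer to \<open>w\<close>. Descending
            from \<open>w'\<close> towards \<open>v'\<close> gives \<open>x\<close> on the level of
            \<open>w\<close>, and the quadrangle on \<open>w'\<close>, \<open>w\<close>,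
            \<open>x\<close> gives \<open>s\<close> below both, at distance at most \<open>k\<close>
            from \<open>v\<close>.\<close>
          case F: False
          have v'w: "d v' w = k" "Suc (d v' w') = k"
            using F adj_dist_le[OF w'(1), of v'] adj_dist_le[OF v'(1), of w] V v'V v' vw' k by linarith+
          obtain x where x: "E w' x" "Suc (d x v') = d w' v'" "Suc (d u x) = d u w'"
            using C[of w' v'] w'V v'V v'w v'(3) lev dist_sym[of v' w'] by auto
          have xV: "x \<in> V" using x adj_V by blast
          have v'x: "Suc (Suc (d v' x)) = k" using x v'w w'V v'V xV dist_sym by metis
          then have "w \<noteq> x" "\<not> E w x" using adj_dist_le[of w x v'] v'V v'w by auto
          then obtain s where s: "E s w" "E s x" "Suc (d u s) = d u w"
            using quadrangle[of u w' w x] assms w' x lev adj_sym by auto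
          have sV: "s \<in> V" using s adj_V by blast
          have "d v s \<le> k"
            using adj_dist_le[OF s(2), of v'] adj_dist_le[OF v'(1), of s] v'V sV v'x by linarith
          then consider "d v s < k" | "d v s = k" by linarith
          then show ?thesis
          proof cases
            case 1
            then show ?thesis using via[of v w s] V k s adj_sym lt by auto
          next
            case 2
            \<comment> \<open>Now \<open>s\<close> and \<open>w\<close> are both at distance
              \<open>k\<close> from \<open>v\<close>, so the triangle condition is used at
              \<open>v\<close> instead of \<open>u\<close>. The vertex \<open>r\<close> is at most
              one level above \<open>s\<close>, hence still below \<open>v\<close>.\<close>
            then obtain r where r: "E r s" "E r w" "Suc (d v r) = d v s"
              using triangle[of v s w] V s k by auto
            have "d u r < d u v" using adj_dist_le[OF r(1) assms] s lev by linarith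
            then show ?thesis using via[of v w r] V k r 2 adj_sym by auto
          qed
        qed
      qed
    qed
  next
    fix v w
    assume V: "v \<in> V" "w \<in> V" and k: "d v w = k" and "v \<noteq> w" and lev: "d u w = d u v"
    then obtain w' where w': "E w w'" "Suc (d w' v) = d w v" using geodesic_step[of w v] by auto
    have w'V: "w' \<in> V" using w' adj_V by blast
    have vw': "Suc (d v w') = k" using w' k V w'V dist_sym by metis
    show "\<exists>v'. E v v' \<and> d v' w \<le> k \<and> Suc (d u v') = d u v"
    proof (cases "d u w' = d u v")
      case False
      have "\<exists>v'. E v v' \<and> Suc (d v' w) = k \<and> Suc (d u v') = d u v"
        by (rule detour_step[OF C assms V k w'(1) vw' lev[symmetric] False])
      then show ?thesis by (metis Suc_n_not_le_n nat_le_linear)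
    next
      case True
      show ?thesis
      proof (cases "v = w'")
        case True
        then obtain x where "E x v" "E x w" "Suc (d u x) = d u v"
          using triangle[of u v w] assms w' lev adj_sym by metis
        moreover have "d x w = k" using \<open>E x w\<close> True adj_dist w' k adj_sym by metis
        ultimately show ?thesis using adj_sym by blast
      next
        case F: False
        then obtain v' where v': "E v v'" "d v' w' \<le> d v w'" "Suc (d u v') = d u v"
          using D[of v w'] V w'V vw' True by auto
        have "v' \<in> V" using v' adj_V by blast
        then have "d v' w \<le> k" using adj_dist_le[OF w'(1), of v'] v' vw' by linarith
        then show ?thesis using v' by blast
      qed
    qed
  qed
qed

lemma descent:
  assumes "u \<in> V" "v \<in> V" "w \<in> V" "d u w < d u v"
  shows "\<exists>v'. E v v' \<and> Suc (d v' w) = d v w \<and> Suc (d u v') = d u v"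
  using descent_aux[OF assms(1), of "d v w"] assms by blast

text \<open>Serves pairs on a common level, where descent does not apply: it suffices that the last
  step of some geodesic leaves the level.\<close>

lemma detour:
  assumes "u \<in> V" "v \<in> V" "E w w'" "Suc (d v w') = d v w" "d u v = d u w" "d u w' \<noteq> d u v"
  shows "\<exists>v'. E v v' \<and> Suc (d v' w) = d v w \<and> Suc (d u v') = d u v"
  by (rule detour_step[where k="d v w" and w'=w']) (use assms adj_V descent in auto)

section \<open>Isometry of intervals\<close>

lemma interval_step_down:
  assumes "p \<in> V" "q \<in> V" "x \<in> I p q" "E x x'" "Suc (d p x') = d p x"
  shows "x' \<in> I p q"
proof -
  have "x' \<in> V" using assms adj_V by blast
  then show ?thesis
    using assms adj_dist_le[OF assms(4), of q] dist_triangle[of p x' q] by (auto simp: interval_iff)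
qed

lemma interval_isometric:
  assumes pq: "p \<in> V" "q \<in> V"
  shows "isometric_subgraph V E (I p q)"
proof (rule isometric_subgraphI)
  show "I p q \<subseteq> V" using interval_V by blast
  fix x y
  assume xy: "x \<in> I p q" "y \<in> I p q" "x \<noteq> y"
  have V: "x \<in> V" "y \<in> V" using xy interval_V by auto
  \<comment> \<open>Steps towards either endpoint stay in the interval, so it remains to find a
    first step towards \<open>y\<close> that also approaches \<open>p\<close> or
    \<open>q\<close>.\<close>
  have step: "\<exists>z\<in>I p q. E x z \<and> Suc (d z y) = d x y"
    if "\<exists>z. E x z \<and> Suc (d z y) = d x y \<and> (Suc (d p z) = d p x \<or> Suc (d q z) = d q x)"
    using that interval_step_down pq xy interval_commute[of p q] by metis
  have sum: "d p x + d q x = d p q" "d p y + d q y = d p q"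
    using xy pq V dist_sym by (auto simp: interval_iff)
  consider "d p y < d p x" | "d q y < d q x" | "d p x = d p y" "d q x = d q y"
    using sum by linarith
  then show "\<exists>z\<in>I p q. E x z \<and> Suc (d z y) = d x y"
  proof cases
    case 1
    then show ?thesis using step descent[of p x y] pq V by blast
  next
    case 2
    then show ?thesis using step descent[of q x y] pq V by blast
  next
    case 3
    obtain y' where y': "E y y'" "Suc (d y' x) = d y x" using geodesic_step[of y x] V xy by auto
    have y'V: "y' \<in> V" using y' adj_V by blast
    have xy': "Suc (d x y') = d x y" using y' V y'V dist_sym by metis
    \<comment> \<open>If \<open>y'\<close> kept both distances it would belong to the interval, and
      \<open>y\<close>, \<open>y'\<close> would form a horizontal edge.\<close>
    have "d p y' \<noteq> d p x \<or> d q y' \<noteq> d q x"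
    proof (rule ccontr)
      assume "\<not> ?thesis"
      then have eq: "d p y' = d p x" "d q y' = d q x" by auto
      then have "y' \<in> I p q" using y'V pq sum dist_sym by (auto simp: interval_iff)
      then show False using no_horizontal_edge[of p q y y'] pq xy y' eq 3 by auto
    qed
    then show ?thesis
      using step detour[of p x y y'] detour[of q x y y'] pq V y' xy' 3 by blast
  qed
qed

section \<open>Joins, meets and modularity\<close>

text \<open>The parts are \<open>{z, w, j}\<close> and \<open>{t, x, y}\<close>, and
  \<open>z\<close>, \<open>t\<close> is the missing edge. Distance 3 keeps the neighbours of
  \<open>z\<close> apart from those of \<open>t\<close>, and any other nonadjacent pair has a common
  neighbour among the six vertices.\<close>

lemma no_K33_minus:
  assumes e: "E z x" "E z y" "E x w" "E y w" "E x j" "E y j" "E w t" "E j t"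
    and ne: "x \<noteq> y" "w \<noteq> j" "\<not> E x y" "\<not> E w j" and zt: "d z t = 3"
  shows False
proof -
  define S where "S = {z, w, j, t, x, y}"
  have V: "z \<in> V" "w \<in> V" "j \<in> V" "t \<in> V" "x \<in> V" "y \<in> V"
    using e adj_V by blast+
  note e' = e[THEN adj_sym]
  have ne': "\<not> E y x" "\<not> E j w" using ne adj_sym by blast+
  have nb: "d z a \<noteq> 0" "d z a \<noteq> 3" "\<not> E a t" if "E z a" for a
    using adj_dist_le[of a t z] adj_dist[OF that] V zt by auto
  have nb': "d a t \<noteq> 0" "d a t \<noteq> 3" "\<not> E z a" "z \<noteq> a" if "E a t" for a
    using adj_dist_le[of z a t] adj_dist[OF that] V zt by auto
  have n: "\<not> E z w" "\<not> E z j" "\<not> E x t" "\<not> E y t" "\<not> E z t"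
      "z \<noteq> w" "z \<noteq> j" "x \<noteq> t" "y \<noteq> t" "z \<noteq> t" "x \<noteq> w" "x \<noteq> j" "y \<noteq> w" "y \<noteq> j"
      "z \<noteq> x" "z \<noteq> y" "w \<noteq> t" "j \<noteq> t"
    using nb nb' e adj_irrefl zt V by auto
  have n': "\<not> E w z" "\<not> E j z" "\<not> E t x" "\<not> E t y" "\<not> E t z"
    using n adj_sym by blast+
  have two: "d a b = 2" if "E a c" "E c b" "\<not> E a b" "a \<noteq> b" for a b c
  proof -
    have "a \<in> V" "b \<in> V" using that adj_V by auto
    then show ?thesis
      using adj_dist_le[OF that(2), of a] adj_dist[OF that(1)] dist_eq_0[of a b]
        adj_iff_dist[of a b] that by linarith
  qed
  have "isometric_subgraph V E S"
  proof (rule isometric_subgraphI)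
    show "S \<subseteq> V" using V by (auto simp: S_def)
    fix a b
    assume ab: "a \<in> S" "b \<in> S" "a \<noteq> b"
    define P where "P a b \<longleftrightarrow> (\<exists>c\<in>S. E a c \<and> Suc (d c b) = d a b)" for a b
    have adj: "P a b" if "E a b" "b \<in> S" for a b
      using that adj_V adj_dist by (auto simp: P_def)
    have dist2: "P a b" if "E a c" "E c b" "\<not> E a b" "a \<noteq> b" "c \<in> S" for a b c
      using that two[of a c b] adj_dist[of c b] by (auto simp: P_def)
    have in_S: "z \<in> S" "w \<in> S" "j \<in> S" "t \<in> S" "x \<in> S" "y \<in> S" by (auto simp: S_def)
    have "d x t = 2" "d w z = 2"
      using two e e' n n' by blast+
    moreover have "d t z = 3" using zt dist_sym V by simp
    ultimately have "P z t" "P t z" using zt e e' in_S by (auto simp: P_def)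
    moreover have "P z w" "P w z" "P z j" "P j z" "P x y" "P y x" "P w j" "P j w"
        "P x t" "P t x" "P y t" "P t y"
      using dist2 e e' n n' ne ne' in_S by metis+
    moreover have "P z x" "P z y" "P x w" "P y w" "P x j" "P y j" "P w t" "P j t"
        "P x z" "P y z" "P w x" "P w y" "P j x" "P j y" "P t w" "P t j"
      using adj e e' in_S by blast+
    moreover have "a = z \<or> a = w \<or> a = j \<or> a = t \<or> a = x \<or> a = y"
        "b = z \<or> b = w \<or> b = j \<or> b = t \<or> b = x \<or> b = y"
      using ab by (auto simp: S_def)
    ultimately have "P a b" using ab(3) by (elim disjE) simp_all
    then show "\<exists>c\<in>S. E a c \<and> Suc (d c b) = d a b" by (simp add: P_def)
  qed
  moreover have "\<forall>a\<in>S. \<forall>b\<in>S. E a b \<longleftrightarrow> ((a \<in> {z,w,j} \<and> b \<in> {t,x,y}) \<or> (b \<in> {z,w,j} \<and> a \<in> {t,x,y}))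
                  \<and> {a, b} \<noteq> {z, t}"
    unfolding S_def using e e' n n' ne ne' adj_irrefl by (auto simp: doubleton_eq_iff)
  moreover have "distinct [z, w, j, t, x, y]" using n ne by auto
  ultimately have "has_isometric_K33_minus V E"
    unfolding has_isometric_K33_minus_def S_def using V by blast
  then show False using swm by (simp add: swm_graph_def)
qed

lemma join_of_covers:
  assumes pq: "p \<in> V" "q \<in> V" and I: "x \<in> I p q" "y \<in> I p q" and E: "E z x" "E z y" "x \<noteq> y"
    and lev: "d p x = Suc (d p z)" "d p y = Suc (d p z)"
  shows "\<exists>j\<in>I p q. x \<in> I p j \<and> y \<in> I p j \<and> d p j = Suc (Suc (d p z)) \<and>
    (\<forall>m\<in>I p q. x \<in> I p m \<longrightarrow> y \<in> I p m \<longrightarrow> j \<in> I p m)"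
proof -
  have V: "x \<in> V" "y \<in> V" "z \<in> V" using E adj_V by auto
  have nxy: "\<not> E x y" using no_horizontal_edge pq I lev by auto
  \<comment> \<open>Seen from an upper bound \<open>m\<close>, the vertex \<open>z\<close> is one
    step farther than \<open>x\<close> and \<open>y\<close>, so the quadrangle condition at
    \<open>m\<close> yields a common upper cover below \<open>m\<close>.\<close>
  have ub: "\<exists>w. E x w \<and> E y w \<and> Suc (d w m) = d x m \<and> d p w = Suc (Suc (d p z)) \<and>
      w \<in> I p m \<and> x \<in> I p w \<and> y \<in> I p w" if m: "m \<in> V" "x \<in> I p m" "y \<in> I p m" for m
  proof -
    have eq: "d m x = d m y" "d x m = d m x" "d y m = d m y"
      using m lev V dist_sym[of m] by (auto simp: interval_iff)
    have "d m z = Suc (d m x)"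
      using m(2) eq lev adj_dist_le[OF E(1) m(1)] dist_triangle[of p z m] dist_sym[of m z] pq m(1) V
      unfolding interval_iff by linarith
    then obtain w where w: "E w x" "E w y" "Suc (d m w) = d m x"
      using quadrangle[of m z x y] m E nxy eq by blast
    have wV: "w \<in> V" using w adj_V by blast
    have sm: "d w m = d m w" using wV m dist_sym by blast
    have pw: "d p w = Suc (d p x)"
      using adj_dist_le[OF w(1) pq(1)] dist_triangle[of p w m] w(3) eq m(1,2) sm pq wV
      unfolding interval_iff by linarith
    moreover have "E x w" "E y w" "d x w = 1" "d y w = 1" using w adj_sym adj_dist by auto
    ultimately show ?thesis
      using w sm eq m lev wV V by (intro exI[of _ w]) (auto simp: interval_iff)
  qed
  obtain j where j: "E x j" "E y j" "Suc (d j q) = d x q" "d p j = Suc (Suc (d p z))"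
      "j \<in> I p q" "x \<in> I p j" "y \<in> I p j"
    using ub[of q] pq I by blast
  have "j \<in> I p m" if m: "m \<in> I p q" "x \<in> I p m" "y \<in> I p m" for m
  proof -
    have mV: "m \<in> V" using m interval_V by blast
    obtain w where w: "E x w" "E y w" "d p w = Suc (Suc (d p z))" "w \<in> I p m"
      using ub[of m] m mV by blast
    have wI: "w \<in> I p q" using interval_trans pq w m by blast
    have "w = j"
    proof (rule ccontr)
      assume ne: "w \<noteq> j"
      have V': "w \<in> V" "j \<in> V" using wI j interval_V by auto
      have nwj: "\<not> E w j" using no_horizontal_edge pq wI j w by auto
      have sums: "d q w + d p w = d p q" "d q j + d p j = d p q" "d q x + d p x = d p q"
        using wI j I V V' pq dist_sym[of q] by (auto simp: interval_iff)
      then have "d q w = d q j" "d q x = Suc (d q w)" using w j lev by auto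
      \<comment> \<open>A second quadrangle, at \<open>q\<close> with apex \<open>x\<close>, puts
        \<open>t\<close> above \<open>w\<close> and \<open>j\<close>. Its level exceeds that of
        \<open>z\<close> by at least 3, which forces \<open>d z t = 3\<close>.\<close>
      then obtain t where t: "E t w" "E t j" "Suc (d q t) = d q w"
        using quadrangle[of q x w j] pq w j ne nwj by blast
      have tV: "t \<in> V" using t adj_V by blast
      have "d p t \<ge> Suc (d p w)"
        using dist_triangle[of p t q] dist_sym[of q t] tV pq t sums by auto
      then have "d z t \<ge> 3" using dist_triangle[of p z t] pq V tV w by auto
      moreover have "d z t \<le> 3"
        using adj_dist_le[OF t(1), of z] adj_dist_le[OF w(1), of z] adj_dist[OF E(1)] V by auto
      ultimately have "d z t = 3" by simp
      then show False
        using no_K33_minus[of z x y w j t] E w j t ne nwj nxy adj_sym by blast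
    qed
    then show ?thesis using w by blast
  qed
  then show ?thesis using j by blast
qed

text \<open>The lemma of Bjorner, Edelman and Ziegler: joins of elements with a common lower cover
  suffice for arbitrary joins. The induction also carries upper semimodularity of the rank.\<close>
lemma interval_join:
  assumes pq: "p \<in> V" "q \<in> V"
    and "c \<in> I p q" "x \<in> I p q" "y \<in> I p q" "c \<in> I p x" "c \<in> I p y"
  shows "\<exists>j\<in>I p q. x \<in> I p j \<and> y \<in> I p j \<and> d p j + d p c \<le> d p x + d p y \<and>
    (\<forall>m\<in>I p q. x \<in> I p m \<longrightarrow> y \<in> I p m \<longrightarrow> j \<in> I p m)"
  using assms(3-)
proof (induction "d p q - d p c" arbitrary: c x y rule: less_induct)
  case less
  have rank: "d p a \<le> d p q" if "a \<in> I p q" for a using that by (simp add: interval_iff)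
  have tr: "a \<in> I p e" if "a \<in> I p b" "b \<in> I p e" "e \<in> I p q" for a b e
    using interval_trans that pq interval_V by blast
  have refl: "a \<in> I p a" if "a \<in> I p q" for a
    using that interval_V by (auto simp: interval_iff)
  consider "x = c" | "y = c" | "x \<noteq> c" "y \<noteq> c" by blast
  then show ?case
  proof cases
    case 1
    then show ?thesis using less refl by (intro bexI[of _ y]) auto
  next
    case 2
    then show ?thesis using less refl by (intro bexI[of _ x]) auto
  next
    case 3
    obtain x1 where x1: "x1 \<in> I p q" "E c x1" "c \<in> I p x1" "x1 \<in> I p x" "d p x1 = Suc (d p c)"
      using interval_cover[of p q c x] less.prems pq 3 by blast
    obtain y1 where y1: "y1 \<in> I p q" "E c y1" "c \<in> I p y1" "y1 \<in> I p y" "d p y1 = Suc (d p c)"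
      using interval_cover[of p q c y] less.prems pq 3 by blast
    \<comment> \<open>The induction is on the corank of the common lower bound, so joins over any
      \<open>e\<close> of higher rank than \<open>c\<close> are available.\<close>
    have IH: "\<exists>j\<in>I p q. a \<in> I p j \<and> b \<in> I p j \<and> d p j + d p e \<le> d p a + d p b \<and>
        (\<forall>m\<in>I p q. a \<in> I p m \<longrightarrow> b \<in> I p m \<longrightarrow> j \<in> I p m)"
      if "d p c < d p e" "e \<in> I p q" "a \<in> I p q" "b \<in> I p q" "e \<in> I p a" "e \<in> I p b" for a b e
      using less.hyps[of e a b] that rank[of e] by auto
    show ?thesis
    proof (cases "x1 = y1")
      case True
      then obtain j where j: "j \<in> I p q" "x \<in> I p j" "y \<in> I p j" "d p j + d p x1 \<le> d p x + d p y"
          "\<forall>m\<in>I p q. x \<in> I p m \<longrightarrow> y \<in> I p m \<longrightarrow> j \<in> I p m"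
        using IH[of x1 x y] x1 y1 less.prems by auto
      then show ?thesis using x1 by (intro bexI[of _ j]) auto
    next
      case False
      \<comment> \<open>Four joins assemble the result: \<open>s\<close> of the covers
        \<open>x1\<close>, \<open>y1\<close>; then \<open>u\<close> of \<open>x\<close>,
        \<open>s\<close> over \<open>x1\<close>; \<open>v\<close> of \<open>y\<close>,
        \<open>s\<close> over \<open>y1\<close>; and \<open>j\<close> of \<open>u\<close>,
        \<open>v\<close> over \<open>s\<close>.\<close>
      obtain s where s: "s \<in> I p q" "x1 \<in> I p s" "y1 \<in> I p s" "d p s = Suc (Suc (d p c))"
          "\<And>m. m \<in> I p q \<Longrightarrow> x1 \<in> I p m \<Longrightarrow> y1 \<in> I p m \<Longrightarrow> s \<in> I p m"
        using join_of_covers[OF pq x1(1) y1(1) x1(2) y1(2) False x1(5) y1(5)] by blast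
      obtain u where u: "u \<in> I p q" "x \<in> I p u" "s \<in> I p u" "d p u + d p x1 \<le> d p x + d p s"
          "\<And>m. m \<in> I p q \<Longrightarrow> x \<in> I p m \<Longrightarrow> s \<in> I p m \<Longrightarrow> u \<in> I p m"
        using IH[of x1 x s] x1 s less.prems by auto
      obtain v where v: "v \<in> I p q" "y \<in> I p v" "s \<in> I p v" "d p v + d p y1 \<le> d p y + d p s"
          "\<And>m. m \<in> I p q \<Longrightarrow> y \<in> I p m \<Longrightarrow> s \<in> I p m \<Longrightarrow> v \<in> I p m"
        using IH[of y1 y s] y1 s less.prems by auto
      obtain j where j: "j \<in> I p q" "u \<in> I p j" "v \<in> I p j" "d p j + d p s \<le> d p u + d p v"
          "\<And>m. m \<in> I p q \<Longrightarrow> u \<in> I p m \<Longrightarrow> v \<in> I p m \<Longrightarrow> j \<in> I p m"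
        using IH[of s u v] s u v by auto
      have "j \<in> I p m" if m: "m \<in> I p q" "x \<in> I p m" "y \<in> I p m" for m
        using s(5) u(5) v(5) j(5) m x1(4) y1(4) tr by meson
      moreover have "x \<in> I p j" "y \<in> I p j" using u v j tr by blast+
      \<comment> \<open>Summing the three rank inequalities cancels \<open>u\<close> and
        \<open>v\<close>; the ranks of \<open>x1\<close>, \<open>y1\<close>, \<open>s\<close> exceed
        that of \<open>c\<close> by 1, 1, 2.\<close>
      moreover have "d p j + d p c \<le> d p x + d p y" using u v j s x1 y1 by linarith
      ultimately show ?thesis using j by blast
    qed
  qed
qed

text \<open>Dual of \<open>interval_join\<close>: the same lemma read from \<open>q\<close>, where
  the rank becomes \<open>d p q\<close> minus \<open>d p\<close> and the semimodular inequality
  turns around.\<close>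

lemma interval_meet:
  assumes pq: "p \<in> V" "q \<in> V"
    and u: "u \<in> I p q" "x \<in> I p q" "y \<in> I p q" "x \<in> I p u" "y \<in> I p u"
  shows "\<exists>m\<in>I p q. m \<in> I p x \<and> m \<in> I p y \<and> d p x + d p y \<le> d p m + d p u \<and>
    (\<forall>l\<in>I p q. l \<in> I p x \<longrightarrow> l \<in> I p y \<longrightarrow> l \<in> I p m)"
proof -
  note rev = interval_reverse[OF pq] and com = interval_commute[OF pq]
  have rank: "d q a + d p a = d p q" if "a \<in> I p q" for a
    using that dist_sym[of q a] pq interval_V[OF that] by (auto simp: interval_iff)
  obtain m where m: "m \<in> I p q" "x \<in> I q m" "y \<in> I q m" "d q m + d q u \<le> d q x + d q y"
      "\<And>l. l \<in> I p q \<Longrightarrow> x \<in> I q l \<Longrightarrow> y \<in> I q l \<Longrightarrow> m \<in> I q l"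
    using interval_join[OF pq(2,1), of u x y] u rev com by auto
  have "d p x + d p y \<le> d p m + d p u"
    using m(4) rank[OF m(1)] rank[OF u(1)] rank[OF u(2)] rank[OF u(3)] by linarith
  then show ?thesis using m u rev by (intro bexI[of _ m]) auto
qed

section \<open>The lattice of an interval and its modularity\<close>

lemma interval_top_bot:
  assumes "p \<in> V" "q \<in> V"
  shows "p \<in> I p q" "q \<in> I p q" "x \<in> I p q \<Longrightarrow> p \<in> I p x"
  using assms interval_V by (auto simp: interval_iff)

lemma interval_lattice:
  assumes pq: "p \<in> V" "q \<in> V"
  shows "lattice (interval_poset V E p q)"
proof -
  define L where "L = interval_poset V E p q"
  have c: "carrier L = I p q" "le L = (\<lambda>x y. x \<in> I p y)" "eq L = (=)"
    by (auto simp: L_def interval_poset_def)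
  have refl: "x \<in> I p x" if "x \<in> I p q" for x
    using that interval_V by (auto simp: interval_iff)
  have "partial_order L"
  proof (unfold_locales, unfold c)
    show "x \<in> I p x" if "x \<in> I p q" for x
      using that by (rule refl)
    show "x = y" if "x \<in> I p y" "y \<in> I p x" for x y
      using that interval_antisym pq by blast
    show "x \<in> I p z" if "x \<in> I p y" "y \<in> I p z" "z \<in> I p q" for x y z
      using that interval_trans pq interval_V by blast
  qed simp_all
  then interpret partial_order L .
  have "lattice L"
  proof unfold_locales
    fix x y
    assume xy: "x \<in> carrier L" "y \<in> carrier L"
    obtain j where "j \<in> I p q" "x \<in> I p j" "y \<in> I p j"
        "\<forall>m\<in>I p q. x \<in> I p m \<longrightarrow> y \<in> I p m \<longrightarrow> j \<in> I p m"
      using interval_join[OF pq, of p x y] xy interval_top_bot[OF pq] unfolding c by blast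
    then show "\<exists>s. least L s (Upper L {x, y})"
      using xy unfolding least_def Upper_def c by (intro exI[of _ j]) auto
    obtain m where "m \<in> I p q" "m \<in> I p x" "m \<in> I p y"
        "\<forall>l\<in>I p q. l \<in> I p x \<longrightarrow> l \<in> I p y \<longrightarrow> l \<in> I p m"
      using interval_meet[OF pq, of q x y] xy interval_top_bot[OF pq] unfolding c by blast
    then show "\<exists>s. greatest L s (Lower L {x, y})"
      using xy unfolding greatest_def Lower_def c by (intro exI[of _ m]) auto
  qed
  then show ?thesis by (simp add: L_def)
qed

lemma interval_modular:
  assumes pq: "p \<in> V" "q \<in> V"
  shows "modular_lattice (interval_poset V E p q)"
proof -
  define L where "L = interval_poset V E p q"
  have c: "carrier L = I p q" "\<And>x y. le L x y \<longleftrightarrow> x \<in> I p y"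
    by (auto simp: L_def interval_poset_def)
  interpret lattice L unfolding L_def using interval_lattice[OF pq] .
  let ?r = "d p"
  have rank_le: "?r x \<le> ?r y" if "x \<sqsubseteq>\<^bsub>L\<^esub> y" for x y
    using that by (auto simp: c interval_iff)
  have rank_eq: "x = y" if "x \<sqsubseteq>\<^bsub>L\<^esub> y" "?r x = ?r y" "y \<in> carrier L" for x y
    using that dist_eq_0[of x y] interval_V by (auto simp: c interval_iff)
  \<comment> \<open>Upper semimodularity over the meet and lower semimodularity under the join give
    the two inequalities of the modular rank identity.\<close>
  have rank: "?r (x \<squnion>\<^bsub>L\<^esub> y) + ?r (x \<sqinter>\<^bsub>L\<^esub> y) = ?r x + ?r y"
    if xy: "x \<in> carrier L" "y \<in> carrier L" for x y
  proof (rule antisym)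
    obtain j where j: "j \<in> carrier L" "x \<sqsubseteq>\<^bsub>L\<^esub> j" "y \<sqsubseteq>\<^bsub>L\<^esub> j"
        "?r j + ?r (x \<sqinter>\<^bsub>L\<^esub> y) \<le> ?r x + ?r y"
      using interval_join[OF pq, of "x \<sqinter>\<^bsub>L\<^esub> y" x y] xy meet_left[of x y] meet_right[of x y]
        meet_closed[of x y] unfolding c by blast
    then show "?r (x \<squnion>\<^bsub>L\<^esub> y) + ?r (x \<sqinter>\<^bsub>L\<^esub> y) \<le> ?r x + ?r y"
      using rank_le[OF join_le[OF j(2,3) xy j(1)]] by linarith
    obtain m where m: "m \<in> carrier L" "m \<sqsubseteq>\<^bsub>L\<^esub> x" "m \<sqsubseteq>\<^bsub>L\<^esub> y"
        "?r x + ?r y \<le> ?r m + ?r (x \<squnion>\<^bsub>L\<^esub> y)"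
      using interval_meet[OF pq, of "x \<squnion>\<^bsub>L\<^esub> y" x y] xy join_left[of x y] join_right[of x y]
        join_closed[of x y] unfolding c by blast
    then show "?r x + ?r y \<le> ?r (x \<squnion>\<^bsub>L\<^esub> y) + ?r (x \<sqinter>\<^bsub>L\<^esub> y)"
      using rank_le[OF meet_le[OF m(2,3) xy m(1)]] by linarith
  qed
  have "x \<squnion>\<^bsub>L\<^esub> (y \<sqinter>\<^bsub>L\<^esub> z) = (x \<squnion>\<^bsub>L\<^esub> y) \<sqinter>\<^bsub>L\<^esub> z"
    if xyz: "x \<in> carrier L" "y \<in> carrier L" "z \<in> carrier L" and le: "x \<sqsubseteq>\<^bsub>L\<^esub> z" for x y z
  proof (rule rank_eq)
    show "x \<squnion>\<^bsub>L\<^esub> (y \<sqinter>\<^bsub>L\<^esub> z) \<sqsubseteq>\<^bsub>L\<^esub> (x \<squnion>\<^bsub>L\<^esub> y) \<sqinter>\<^bsub>L\<^esub> z"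
    proof (rule meet_le)
      have "y \<sqinter>\<^bsub>L\<^esub> z \<sqsubseteq>\<^bsub>L\<^esub> x \<squnion>\<^bsub>L\<^esub> y"
        using le_trans[OF meet_left join_right] xyz by simp
      then show "x \<squnion>\<^bsub>L\<^esub> (y \<sqinter>\<^bsub>L\<^esub> z) \<sqsubseteq>\<^bsub>L\<^esub> x \<squnion>\<^bsub>L\<^esub> y"
        using xyz by (simp add: join_le join_left)
      show "x \<squnion>\<^bsub>L\<^esub> (y \<sqinter>\<^bsub>L\<^esub> z) \<sqsubseteq>\<^bsub>L\<^esub> z"
        using xyz le by (simp add: join_le meet_right)
    qed (use xyz in simp_all)
    have "x \<squnion>\<^bsub>L\<^esub> z = z"
      using xyz le by (intro le_antisym) (simp_all add: join_le join_right)
    then have j: "(x \<squnion>\<^bsub>L\<^esub> y) \<squnion>\<^bsub>L\<^esub> z = y \<squnion>\<^bsub>L\<^esub> z"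
      using xyz weak_join_assoc[of y x z] join_comm[of L x y] by (simp add: eq_is_equal)
    have "x \<sqinter>\<^bsub>L\<^esub> z = x"
      using xyz le by (intro le_antisym) (simp_all add: meet_le meet_left)
    then have m: "x \<sqinter>\<^bsub>L\<^esub> (y \<sqinter>\<^bsub>L\<^esub> z) = x \<sqinter>\<^bsub>L\<^esub> y"
      using xyz weak_meet_assoc[of x z y] meet_comm[of L y z] by (simp add: eq_is_equal)
    \<comment> \<open>By the rank identity both sides equal
      \<open>?r x + ?r (y \<sqinter> z) - ?r (x \<sqinter> y)\<close>; being comparable, they then
      coincide.\<close>
    show "?r (x \<squnion>\<^bsub>L\<^esub> (y \<sqinter>\<^bsub>L\<^esub> z)) = ?r ((x \<squnion>\<^bsub>L\<^esub> y) \<sqinter>\<^bsub>L\<^esub> z)"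
      using rank[of x "y \<sqinter>\<^bsub>L\<^esub> z"] rank[of "x \<squnion>\<^bsub>L\<^esub> y" z] rank[of x y] rank[of y z] xyz j m
      by simp
  qed (use xyz in simp)
  then show ?thesis using lattice_axioms unfolding modular_lattice_def L_def by blast
qed

lemma interval_covering_graph:
  assumes pq: "p \<in> V" "q \<in> V"
  shows "induced_is_covering_graph E (interval_poset V E p q)"
proof -
  have "E x y \<longleftrightarrow> (E x y \<and> d p y = Suc (d p x)) \<or> (E y x \<and> d p x = Suc (d p y))"
    if "x \<in> I p q" "y \<in> I p q" for x y
    using no_horizontal_edge[OF pq that] adj_dist_le[of x y p] pq adj_sym
    by (metis le_SucE le_antisym)
  then show ?thesis
    unfolding induced_is_covering_graph_def interval_covers_iff[OF pq]
    by (simp add: interval_poset_def)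
qed

end

section \<open>The converse\<close>

context tri_graph
begin

lemma modular_intervals_imp_swm:
  assumes H: "\<And>p q. p \<in> V \<Longrightarrow> q \<in> V \<Longrightarrow> modular_lattice (interval_poset V E p q)"
    and cov: "\<And>p q. p \<in> V \<Longrightarrow> q \<in> V \<Longrightarrow> induced_is_covering_graph E (interval_poset V E p q)"
  shows "swm_graph V E"
proof -
  have c: "carrier (interval_poset V E p q) = I p q" "le (interval_poset V E p q) = (\<lambda>x y. x \<in> I p y)"
      "eq (interval_poset V E p q) = (=)" for p q
    by (auto simp: interval_poset_def)
  have lat: "lattice (interval_poset V E p q)" if "p \<in> V" "q \<in> V" for p q
    using H that by (auto simp: modular_lattice_def)
  have qc: "quadrangle_cond V E u" if u: "u \<in> V" for u
    unfolding quadrangle_cond_def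
  proof (intro ballI impI; elim conjE)
    fix v w z
    assume V: "v \<in> V" "w \<in> V" "z \<in> V" and vz: "d v z = 1" "d w z = 1" "d v w = 2"
      and "2 \<le> d u v" and eq: "d u v = d u w" and uw: "d u w = d u z - 1" "1 \<le> d u z"
    \<comment> \<open>In the interval from \<open>u\<close> to \<open>z\<close> both
      \<open>v\<close> and \<open>w\<close> lie one level below the top; their meet will be the
      required common neighbour.\<close>
    define L where "L = interval_poset V E u z"
    interpret lattice L unfolding L_def using lat u V by blast
    note cL = c[of u z, folded L_def]
    have modular: "a \<squnion>\<^bsub>L\<^esub> (b \<sqinter>\<^bsub>L\<^esub> e) = (a \<squnion>\<^bsub>L\<^esub> b) \<sqinter>\<^bsub>L\<^esub> e"
      if "a \<in> carrier L" "b \<in> carrier L" "e \<in> carrier L" "a \<sqsubseteq>\<^bsub>L\<^esub> e" for a b e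
      using H[of u z] u V that unfolding modular_lattice_def L_def by blast
    have rank_eq: "a = b" if "a \<sqsubseteq>\<^bsub>L\<^esub> b" "d u b \<le> d u a" "b \<in> carrier L" for a b
      using that dist_eq_0[of a b] interval_V by (auto simp: cL interval_iff)
    have top: "a = z" if "b \<sqsubseteq>\<^bsub>L\<^esub> a" "b \<noteq> a" "a \<in> carrier L" "Suc (d u b) = d u z" for a b
    proof -
      have "d u a \<le> d u z" "a \<in> V" using that by (auto simp: cL interval_iff)
      moreover have "d u b < d u a" using rank_eq[of b a] that by force
      ultimately have "d u a = d u z" using that by linarith
      then show "a = z" using that dist_eq_0[of a z] V by (auto simp: cL interval_iff)
    qed
    have half: "E (v \<sqinter>\<^bsub>L\<^esub> w) v \<and> d u v = Suc (d u (v \<sqinter>\<^bsub>L\<^esub> w))"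
      if L: "v \<in> carrier L" "w \<in> carrier L" and vw: "v \<noteq> w"
        and r: "Suc (d u v) = d u z" "Suc (d u w) = d u z" for v w
    proof -
      define x where "x = v \<sqinter>\<^bsub>L\<^esub> w"
      have x: "x \<in> carrier L" "x \<sqsubseteq>\<^bsub>L\<^esub> v" "x \<sqsubseteq>\<^bsub>L\<^esub> w"
        using L by (auto simp: x_def meet_left meet_right)
      have "x \<noteq> v" using x rank_eq[of v w] vw r L by auto
      \<comment> \<open>The aim is \<open>y = v\<close>. Since \<open>y\<close> is not below
        \<open>w\<close>, the join of \<open>y\<close> and \<open>w\<close> is the top
        \<open>z\<close>, and the modular law for \<open>y\<close>, \<open>w\<close>,
        \<open>v\<close> turns \<open>y\<close> into \<open>v\<close>.\<close>
      obtain y where y: "y \<in> carrier L" "E x y" "x \<sqsubseteq>\<^bsub>L\<^esub> y" "y \<sqsubseteq>\<^bsub>L\<^esub> v" "d u y = Suc (d u x)"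
        using interval_cover[of u z x v] u V x L \<open>x \<noteq> v\<close> by (auto simp: cL)
      have "\<not> y \<sqsubseteq>\<^bsub>L\<^esub> w"
      proof
        assume "y \<sqsubseteq>\<^bsub>L\<^esub> w"
        then have "y \<sqsubseteq>\<^bsub>L\<^esub> x" unfolding x_def using y L by (intro meet_le) auto
        then show False using y by (auto simp: cL interval_iff)
      qed
      then have "w \<noteq> y \<squnion>\<^bsub>L\<^esub> w" using join_left[OF y(1) L(2)] by auto
      then have "y \<squnion>\<^bsub>L\<^esub> w = z"
        using top[of w "y \<squnion>\<^bsub>L\<^esub> w"] y L join_right r by auto
      then have "y \<squnion>\<^bsub>L\<^esub> x = z \<sqinter>\<^bsub>L\<^esub> v"
        using modular[of y w v] y L meet_comm unfolding x_def by metis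
      moreover have "y \<squnion>\<^bsub>L\<^esub> x = y"
        using y x by (intro le_antisym) (simp_all add: join_le join_left)
      moreover have zL: "z \<in> carrier L" "v \<sqsubseteq>\<^bsub>L\<^esub> z"
        using u V L by (auto simp: cL interval_iff)
      moreover have "z \<sqinter>\<^bsub>L\<^esub> v = v"
        using zL L by (intro le_antisym) (simp_all add: meet_le meet_right)
      ultimately show ?thesis using y unfolding x_def by auto
    qed
    have L: "v \<in> carrier L" "w \<in> carrier L"
      using u V vz eq uw by (auto simp: cL interval_iff)
    have "v \<noteq> w" using vz V by auto
    then show "\<exists>x\<in>V. E x v \<and> E x w \<and> d u x = d u v - 1"
      using half[of v w] half[of w v] L eq uw meet_comm[of L v w] adj_V
      by (intro bexI[of _ "v \<sqinter>\<^bsub>L\<^esub> w"]) auto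
  qed
  have "\<not> has_induced_K4_minus V E"
  proof
    assume "has_induced_K4_minus V E"
    then obtain a b e f where V: "a \<in> V" "b \<in> V" "e \<in> V" "f \<in> V" and ef: "e \<noteq> f" "\<not> E e f"
      and E: "E a b" "E a e" "E a f" "E b e" "E b f"
      unfolding has_induced_K4_minus_def by auto
    have "d e f \<noteq> 0" "d e f \<noteq> 1" using V ef dist_eq_0 adj_iff_dist by auto
    moreover have 1: "d e a = 1" "d a f = 1" "d e b = 1" "d b f = 1"
      using E adj_dist adj_sym by auto
    moreover have "d e f \<le> 2" using dist_triangle[of e a f] 1 V by auto
    \<comment> \<open>The adjacent vertices \<open>a\<close> and \<open>b\<close> share the middle
      level of this interval, so neither can cover the other.\<close>
    ultimately have "a \<in> I e f" "b \<in> I e f" using V by (auto simp: interval_iff)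
    then have "covers (interval_poset V E e f) a b \<or> covers (interval_poset V E e f) b a"
      using cov[of e f] V E unfolding induced_is_covering_graph_def c by blast
    then show False using interval_covers_iff V 1 by auto
  qed
  moreover have "\<not> has_isometric_K33_minus V E"
  proof
    assume "has_isometric_K33_minus V E"
    then obtain a1 a2 a3 b1 b2 b3 where V: "a1 \<in> V" "a2 \<in> V" "a3 \<in> V" "b1 \<in> V" "b2 \<in> V" "b3 \<in> V"
      and dist: "distinct [a1, a2, a3, b1, b2, b3]"
      and adj: "\<forall>x\<in>{a1,a2,a3,b1,b2,b3}. \<forall>y\<in>{a1,a2,a3,b1,b2,b3}.
        E x y \<longleftrightarrow> ((x \<in> {a1,a2,a3} \<and> y \<in> {b1,b2,b3}) \<or> (y \<in> {a1,a2,a3} \<and> x \<in> {b1,b2,b3}))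
                  \<and> {x, y} \<noteq> {a1, b1}"
      and iso: "isometric_subgraph V E {a1,a2,a3,b1,b2,b3}"
      unfolding has_isometric_K33_minus_def by (elim bexE conjE) (rule that)
    note ad = adj[THEN bspec, THEN bspec]
    have e: "E a1 b2" "E a1 b3" "E b2 a2" "E b2 a3" "E b3 a2" "E b3 a3" "E a2 b1" "E a3 b1"
      using dist by (auto simp: ad doubleton_eq_iff)
    have ne: "\<not> E a1 b1" "\<not> (E a1 x \<and> E x b1)" if "x \<in> {a1,a2,a3,b1,b2,b3}" for x
      using that dist by (auto simp: ad doubleton_eq_iff)
    have walk: "walk_of_len E {a1,a2,a3,b1,b2,b3} a1 b1 (d a1 b1)"
      using iso gdist_walk[of E "{a1,a2,a3,b1,b2,b3}" a1 b1]
      unfolding isometric_subgraph_def by simp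
    have "a1 \<noteq> b1" "\<not> E a1 b1" using dist ne(1)[of a1] by auto
    then have "d a1 b1 \<noteq> 0" "d a1 b1 \<noteq> 1" using V dist_eq_0 adj_iff_dist by auto
    \<comment> \<open>By isometry a path of length 2 could be taken inside the six vertices, none of
      which is adjacent to both \<open>a1\<close> and \<open>b1\<close>.\<close>
    moreover have "d a1 b1 \<noteq> 2"
    proof
      assume "d a1 b1 = 2"
      with walk have "walk_of_len E {a1,a2,a3,b1,b2,b3} a1 b1 (Suc (Suc 0))"
        by (simp only: numeral_2_eq_2)
      then obtain x where "E a1 x" "walk_of_len E {a1,a2,a3,b1,b2,b3} x b1 (Suc 0)"
        by (auto simp only: walk_of_len_Suc[of _ _ _ _ "Suc 0"])
      then show False
        using ne(2)[of x] walk_of_len_in by (auto simp only: walk_of_len_0 walk_of_len_Suc)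
    qed
    moreover have "d a1 a2 \<le> 2" "d a1 a3 \<le> 2"
      using adj_dist_le[OF e(3), of a1] adj_dist_le[OF e(4), of a1] adj_dist[OF e(1)] V by auto
    ultimately have d: "d a1 b1 = 3" "d a1 a2 = 2" "d a1 a3 = 2"
      using adj_dist_le[OF e(7), of a1] adj_dist_le[OF e(8), of a1] V by auto
    have "d b2 b1 = 2" "d b3 b1 = 2"
      using adj_dist_le[OF e(1), of b1] adj_dist_le[OF e(2), of b1]
        adj_dist_le[OF e(3), of b1] adj_dist_le[OF e(5), of b1] adj_dist[OF e(7)] V d by auto
    then have I: "b2 \<in> I a1 b1" "b3 \<in> I a1 b1" "a2 \<in> I a1 b1" "a3 \<in> I a1 b1"
      using V d e[THEN adj_dist] by (auto simp: interval_iff)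
    have le: "b2 \<in> I a1 a2" "b2 \<in> I a1 a3" "b3 \<in> I a1 a2" "b3 \<in> I a1 a3"
      using V d e[THEN adj_dist] by (auto simp: interval_iff)
    define L where "L = interval_poset V E a1 b1"
    interpret lattice L unfolding L_def using lat V by blast
    note cL = c[of a1 b1, folded L_def]
    \<comment> \<open>The distinct elements \<open>b2\<close>, \<open>b3\<close> have rank 1, so
      their join has rank at least 2. It lies below \<open>a2\<close> and \<open>a3\<close>, both of
      rank 2, and would equal both.\<close>
    define j where "j = b2 \<squnion>\<^bsub>L\<^esub> b3"
    have jI: "j \<in> I a1 b1" using join_closed[of b2 b3] I by (simp add: j_def cL)
    have j: "b2 \<in> I a1 j" "b3 \<in> I a1 j" "j \<in> I a1 a2" "j \<in> I a1 a3"
      using join_left[of b2 b3] join_right[of b2 b3] join_le[of b2 a2 b3] join_le[of b2 a3 b3] I le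
      by (simp_all add: j_def cL)
    have jV: "j \<in> V" using jI interval_V by blast
    have "d a1 j \<noteq> 1"
    proof
      assume "d a1 j = 1"
      then have "d b2 j = 0" "d b3 j = 0" using j e[THEN adj_dist] by (auto simp: interval_iff)
      then show False using dist_eq_0 V jV dist by auto
    qed
    then have "d a1 j \<ge> 2" using j e[THEN adj_dist] by (auto simp: interval_iff)
    then have "d j a2 = 0" "d j a3 = 0" using j d by (auto simp: interval_iff)
    then show False using dist_eq_0 V jV dist by auto
  qed
  ultimately show ?thesis
    using qc tri by (auto simp: swm_graph_def weakly_modular_def)
qed

end

theorem theorem6p1:
  fixes V :: "'a set" and E :: "'a \<Rightarrow> 'a \<Rightarrow> bool"
  assumes "connected_graph V E"
    and "\<forall>u\<in>V. triangle_cond V E u"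
  shows "swm_graph V E \<longleftrightarrow>
    (\<forall>p\<in>V. \<forall>q\<in>V.
       modular_lattice (interval_poset V E p q) \<and>
       induced_is_covering_graph E (interval_poset V E p q) \<and>
       isometric_subgraph V E (interval V E p q))"
proof
  assume "swm_graph V E"
  then interpret swm V E using assms by unfold_locales
  show "\<forall>p\<in>V. \<forall>q\<in>V.
       modular_lattice (interval_poset V E p q) \<and>
       induced_is_covering_graph E (interval_poset V E p q) \<and>
       isometric_subgraph V E (interval V E p q)"
    using interval_modular interval_covering_graph interval_isometric by blast
next
  assume *: "\<forall>p\<in>V. \<forall>q\<in>V.
       modular_lattice (interval_poset V E p q) \<and>
       induced_is_covering_graph E (interval_poset V E p q) \<and>
       isometric_subgraph V E (interval V E p q)"
  interpret tri_graph V E using assms by unfold_locales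
  show "swm_graph V E" using * by (intro modular_intervals_imp_swm) auto
qed

end
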